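(* Let $A\in\mathbb{H}^{m\times n}$ have rank $r$, and let $M$ and $N$ be positive definite quaternion matrices of order $m$ and $n$, respectively. Then $$A^{\dagger}_{M,N}=\lim_{\lambda\to 0}A^{\sharp}(\lambda I+AA^{\sharp})^{-1},$$ where $A^{\sharp}=N^{-1}A^{*}M$ and $\lambda$ ranges over the positive real numbers.
   Context: $\mathbb{H}$ is the skew field of real quaternions; $\mathbb{H}^{m\times n}$ is the set of $m\times n$ quaternion matrices; $A^{*}$ is the conjugate transpose. A matrix $P\in\mathbb{H}^{n\times n}$ is positive definite if it is Hermitian ($P^*=P$) and $x^{*}Px>0$ for every nonzero $x\in\mathbb{H}^{n}$. The weighted Moore-Penrose inverse $A^{\dagger}_{M,N}$ of $A$ (written also $A^{+}_{M,N}$) is the unique $X\in\mathbb{H}^{n\times m}$ with $AXA=A$, $XAX=X$, $(MAX)^{*}=MAX$, $(NXA)^{*}=NXA$. *)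

theory Defs
  imports "HOL-Analysis.Analysis"
begin

section \<open>The skew field of real quaternions\<close>

text \<open>The quaternion \<open>a + b i + c j + d k\<close> is \<open>Quat a b c d\<close>.\<close>

codatatype quat = Quat (QRe: real) (QIm1: real) (QIm2: real) (QIm3: real)

lemma quat_eqI [intro?]:
  "QRe x = QRe y \<Longrightarrow> QIm1 x = QIm1 y \<Longrightarrow> QIm2 x = QIm2 y \<Longrightarrow> QIm3 x = QIm3 y \<Longrightarrow> x = y"
  by (rule quat.expand) simp

lemma quat_eq_iff:
  "x = y \<longleftrightarrow> QRe x = QRe y \<and> QIm1 x = QIm1 y \<and> QIm2 x = QIm2 y \<and> QIm3 x = QIm3 y"
  by (auto intro: quat_eqI)

instantiation quat :: ab_group_add
begin

primcorec zero_quat where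
  "QRe 0 = 0"
| "QIm1 0 = 0"
| "QIm2 0 = 0"
| "QIm3 0 = 0"

primcorec plus_quat where
  "QRe (x + y) = QRe x + QRe y"
| "QIm1 (x + y) = QIm1 x + QIm1 y"
| "QIm2 (x + y) = QIm2 x + QIm2 y"
| "QIm3 (x + y) = QIm3 x + QIm3 y"

primcorec uminus_quat where
  "QRe (- x) = - QRe x"
| "QIm1 (- x) = - QIm1 x"
| "QIm2 (- x) = - QIm2 x"
| "QIm3 (- x) = - QIm3 x"

primcorec minus_quat where
  "QRe (x - y) = QRe x - QRe y"
| "QIm1 (x - y) = QIm1 x - QIm1 y"
| "QIm2 (x - y) = QIm2 x - QIm2 y"
| "QIm3 (x - y) = QIm3 x - QIm3 y"

instance
  by standard (simp_all add: quat_eq_iff)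

end

definition quat_norm2 :: "quat \<Rightarrow> real" where
  "quat_norm2 x = (QRe x)\<^sup>2 + (QIm1 x)\<^sup>2 + (QIm2 x)\<^sup>2 + (QIm3 x)\<^sup>2"

lemma quat_norm2_eq_0_iff: "quat_norm2 x = 0 \<longleftrightarrow> x = 0"
  by (simp add: quat_norm2_def quat_eq_iff add_nonneg_eq_0_iff)

instantiation quat :: real_div_algebra
begin

primcorec one_quat where
  "QRe 1 = 1"
| "QIm1 1 = 0"
| "QIm2 1 = 0"
| "QIm3 1 = 0"

primcorec times_quat where
  "QRe (x * y) = QRe x * QRe y - QIm1 x * QIm1 y - QIm2 x * QIm2 y - QIm3 x * QIm3 y"
| "QIm1 (x * y) = QRe x * QIm1 y + QIm1 x * QRe y + QIm2 x * QIm3 y - QIm3 x * QIm2 y"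
| "QIm2 (x * y) = QRe x * QIm2 y - QIm1 x * QIm3 y + QIm2 x * QRe y + QIm3 x * QIm1 y"
| "QIm3 (x * y) = QRe x * QIm3 y + QIm1 x * QIm2 y - QIm2 x * QIm1 y + QIm3 x * QRe y"

primcorec inverse_quat where
  "QRe (inverse x) = QRe x / quat_norm2 x"
| "QIm1 (inverse x) = - QIm1 x / quat_norm2 x"
| "QIm2 (inverse x) = - QIm2 x / quat_norm2 x"
| "QIm3 (inverse x) = - QIm3 x / quat_norm2 x"

definition divide_quat :: "quat \<Rightarrow> quat \<Rightarrow> quat" where
  "divide_quat x y = x * inverse y"

primcorec scaleR_quat where
  "QRe (scaleR r x) = r * QRe x"
| "QIm1 (scaleR r x) = r * QIm1 x"
| "QIm2 (scaleR r x) = r * QIm2 x"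
| "QIm3 (scaleR r x) = r * QIm3 x"

instance
proof
  fix x :: quat
  assume "x \<noteq> 0"
  then have n: "quat_norm2 x \<noteq> 0"
    by (simp add: quat_norm2_eq_0_iff)
  have "(a * a + b * b + c * c + d * d) / quat_norm2 x = 1"
    if "a = QRe x" "b = QIm1 x" "c = QIm2 x" "d = QIm3 x" for a b c d
    using n that by (simp add: quat_norm2_def power2_eq_square)
  then have one: "QRe x * QRe x / quat_norm2 x + QIm1 x * QIm1 x / quat_norm2 x
      + QIm2 x * QIm2 x / quat_norm2 x + QIm3 x * QIm3 x / quat_norm2 x = 1"
    by (simp add: add_divide_distrib)
  show "inverse x * x = 1" "x * inverse x = 1"
    using one by (simp_all add: quat_eq_iff mult.commute)
qed (simp_all add: quat_eq_iff divide_quat_def quat_norm2_def algebra_simps)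

end

instantiation quat :: real_normed_div_algebra
begin

definition norm_quat :: "quat \<Rightarrow> real" where
  "norm_quat x = sqrt (quat_norm2 x)"

definition sgn_quat :: "quat \<Rightarrow> quat" where
  "sgn_quat x = x /\<^sub>R norm x"

definition dist_quat :: "quat \<Rightarrow> quat \<Rightarrow> real" where
  "dist_quat x y = norm (x - y)"

definition uniformity_quat [code del]:
  "(uniformity :: (quat \<times> quat) filter) = (INF e\<in>{0 <..}. principal {(x, y). dist x y < e})"

definition open_quat [code del]:
  "open (U :: quat set) \<longleftrightarrow> (\<forall>x\<in>U. eventually (\<lambda>(x', y). x' = x \<longrightarrow> y \<in> U) uniformity)"

instance
proof
  fix r :: real and x y :: quat and S :: "quat set"
  have nrm: "norm z = norm ((QRe z, QIm1 z), (QIm2 z, QIm3 z))" for z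
    by (simp add: norm_quat_def quat_norm2_def norm_Pair)
  show "norm x = 0 \<longleftrightarrow> x = 0"
    by (simp add: norm_quat_def quat_norm2_eq_0_iff)
  show "norm (x + y) \<le> norm x + norm y"
    using norm_triangle_ineq[of "((QRe x, QIm1 x), (QIm2 x, QIm3 x))" "((QRe y, QIm1 y), (QIm2 y, QIm3 y))"]
    by (simp add: nrm)
  have "quat_norm2 (r *\<^sub>R x) = r\<^sup>2 * quat_norm2 x"
    by (simp add: quat_norm2_def power_mult_distrib distrib_left)
  then show "norm (r *\<^sub>R x) = \<bar>r\<bar> * norm x"
    by (simp add: norm_quat_def real_sqrt_mult)
  have "quat_norm2 (x * y) = quat_norm2 x * quat_norm2 y"
    unfolding quat_norm2_def times_quat.simps by algebra
  then show "norm (x * y) = norm x * norm y"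
    by (simp add: norm_quat_def real_sqrt_mult)
qed (rule sgn_quat_def dist_quat_def open_quat uniformity_quat)+

end

primcorec qcnj :: "quat \<Rightarrow> quat" where
  "QRe (qcnj x) = QRe x"
| "QIm1 (qcnj x) = - QIm1 x"
| "QIm2 (qcnj x) = - QIm2 x"
| "QIm3 (qcnj x) = - QIm3 x"


section \<open>Quaternion matrices\<close>

definition qadjoint :: "quat^'n^'m \<Rightarrow> quat^'m^'n" where
  "qadjoint A = transpose (map_matrix qcnj A)"

definition qhermitian :: "quat^'n^'n \<Rightarrow> bool" where
  "qhermitian P \<longleftrightarrow> qadjoint P = P"

text \<open>Positivity of the quaternion \<open>x\<^sup>* P x\<close> means that it is a positive real number.\<close>

definition qposdef :: "quat^'n^'n \<Rightarrow> bool" where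
  "qposdef P \<longleftrightarrow> qhermitian P \<and>
     (\<forall>x. x \<noteq> 0 \<longrightarrow> (\<exists>c::real. 0 < c \<and> (\<Sum>i\<in>UNIV. qcnj (x $ i) * (P *v x) $ i) = of_real c))"

text \<open>The rank is the maximal number of columns that are linearly independent in the
  right \<open>\<bbbH>\<close>-vector space of column vectors. The library's \<open>rank\<close> and \<open>independent\<close> require a
  commutative field. Column indices are counted, so equal columns are distinguished.\<close>

definition right_indep_columns :: "quat^'n^'m \<Rightarrow> 'n set \<Rightarrow> bool" where
  "right_indep_columns A S \<longleftrightarrow>
     (\<forall>c :: 'n \<Rightarrow> quat. (\<forall>i. (\<Sum>j\<in>S. A $ i $ j * c j) = 0) \<longrightarrow> (\<forall>j\<in>S. c j = 0))"

definition qrank :: "quat^'n^'m \<Rightarrow> nat" where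
  "qrank A = Max {card S | S. right_indep_columns A S}"

definition is_weighted_mp_inverse ::
  "quat^'m^'m \<Rightarrow> quat^'n^'n \<Rightarrow> quat^'n^'m \<Rightarrow> quat^'m^'n \<Rightarrow> bool" where
  "is_weighted_mp_inverse M N A X \<longleftrightarrow>
     A ** X ** A = A \<and> X ** A ** X = X \<and>
     qhermitian (M ** A ** X) \<and> qhermitian (N ** X ** A)"

definition weighted_mp_inverse ::
  "quat^'m^'m \<Rightarrow> quat^'n^'n \<Rightarrow> quat^'n^'m \<Rightarrow> quat^'m^'n" where
  "weighted_mp_inverse M N A = (THE X. is_weighted_mp_inverse M N A X)"

definition weighted_adjoint ::
  "quat^'m^'m \<Rightarrow> quat^'n^'n \<Rightarrow> quat^'n^'m \<Rightarrow> quat^'m^'n" where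
  "weighted_adjoint M N A = matrix_inv N ** qadjoint A ** M"

end

theory Submission
  imports Defs
begin

text \<open>
  Put \<open>S = A\<^sup>\<sharp>\<close> and \<open>B = A S\<close>. Since \<open>M B = S\<^sup>* N S\<close> and \<open>N S A = A\<^sup>* M A\<close>, definiteness shows that
  \<open>B Z = 0\<close> forces \<open>S Z = 0\<close>, and \<open>B\<^sup>2 Z = 0\<close> forces \<open>B Z = 0\<close>. By a dimension count over the reals
  \<open>B\<close> therefore has a group inverse \<open>G\<close>, and \<open>S G\<close> is the weighted Moore-Penrose inverse.
  With \<open>R = (\<lambda> I + B)\<^sup>-\<^sup>1\<close>, the identities \<open>S G B = S\<close> and \<open>G\<^sup>2 B = G\<close> give
  \<open>S R = S G - \<lambda> S (G R)\<close> and \<open>G R = G\<^sup>2 - \<lambda> G (G R)\<close>. The second identity bounds \<open>G R\<close> for small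
  \<open>\<lambda>\<close>, and then the first one gives the limit.
\<close>

section \<open>Quaternions as a Euclidean space\<close>

text \<open>A Euclidean structure on \<open>quat\<close> makes the quaternion matrices a
  finite-dimensional real space, so dimension counts and boundedness of linear maps apply despite
  the noncommuting scalars.\<close>

instantiation quat :: real_inner
begin

definition inner_quat :: "quat \<Rightarrow> quat \<Rightarrow> real" where
  "inner x y = QRe x * QRe y + QIm1 x * QIm1 y + QIm2 x * QIm2 y + QIm3 x * QIm3 y"

instance
proof
  fix x y z :: quat and r :: real
  show "0 \<le> inner x x"
    by (simp add: inner_quat_def)
  show "inner x x = 0 \<longleftrightarrow> x = 0"
    using quat_norm2_eq_0_iff[of x] by (simp add: inner_quat_def quat_norm2_def power2_eq_square)
  show "norm x = sqrt (inner x x)"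
    by (simp add: norm_quat_def quat_norm2_def inner_quat_def power2_eq_square)
qed (simp_all add: inner_quat_def algebra_simps)

end

instantiation quat :: euclidean_space
begin

definition Basis_quat :: "quat set" where
  "Basis = {Quat 1 0 0 0, Quat 0 1 0 0, Quat 0 0 1 0, Quat 0 0 0 1}"

instance
proof
  show "(Basis :: quat set) \<noteq> {}" "finite (Basis :: quat set)"
    by (simp_all add: Basis_quat_def)
next
  fix u v :: quat
  assume "u \<in> Basis" "v \<in> Basis"
  then show "inner u v = (if u = v then 1 else 0)"
    unfolding Basis_quat_def by (elim insertE emptyE) (simp_all add: inner_quat_def)
next
  fix x :: quat
  show "(\<forall>u\<in>Basis. inner x u = 0) \<longleftrightarrow> x = 0"
    by (simp add: Basis_quat_def inner_quat_def, simp add: quat_eq_iff)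
qed

end

lemma qcnj_0 [simp]: "qcnj 0 = 0"
  by (simp add: quat_eq_iff)

lemma qcnj_add: "qcnj (x + y) = qcnj x + qcnj y"
  by (simp add: quat_eq_iff)

lemma qcnj_mult: "qcnj (x * y) = qcnj y * qcnj x"
  by (simp add: quat_eq_iff algebra_simps)

lemma qcnj_qcnj [simp]: "qcnj (qcnj x) = x"
  by (simp add: quat_eq_iff)

lemma qcnj_sum: "qcnj (sum f S) = (\<Sum>i\<in>S. qcnj (f i))"
  by (induction S rule: infinite_finite_induct) (simp_all add: qcnj_add)

lemma QRe_of_real [simp]: "QRe (of_real c) = c"
  by (simp add: of_real_def)


section \<open>Matrix algebra\<close>

lemma matrix_diff_ldistrib:
  fixes A :: "'a::ring_1^'n^'m"
  shows "A ** (B - C) = A ** B - A ** C"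
  by (simp add: matrix_matrix_mult_def vec_eq_iff right_diff_distrib sum_subtractf)

lemma matrix_add_rdistrib:
  fixes A :: "'a::semiring_1^'n^'m"
  shows "(A + B) ** C = A ** C + B ** C"
  by (simp add: matrix_matrix_mult_def vec_eq_iff distrib_right sum.distrib)

lemma linear_matrix_mult_left:
  fixes A :: "'a::real_algebra_1^'n^'m"
  shows "linear (\<lambda>Z :: 'a^'k^'n. A ** Z)"
  by (rule linearI) (simp_all add: matrix_add_ldistrib matrix_scalar_ac scalar_matrix_assoc)

lemma qadjoint_mult: "qadjoint (A ** B) = qadjoint B ** qadjoint A"
  by (simp add: qadjoint_def transpose_def map_matrix_def matrix_matrix_mult_def vec_eq_iff
      qcnj_sum qcnj_mult)

lemma qadjoint_qadjoint [simp]: "qadjoint (qadjoint A) = A"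
  by (simp add: qadjoint_def transpose_def map_matrix_def vec_eq_iff)

text \<open>Left multiplication by \<open>P\<close> is an injective real-linear endomorphism of a
  finite-dimensional space, hence surjective. This gives a right inverse \<open>R\<close>, and
  cancelling \<open>P\<close> in \<open>P (R P - 1) = 0\<close> makes it two-sided.\<close>

lemma matrix_inverse_of_cancel:
  fixes P :: "quat^'n^'n"
  assumes "\<And>Z :: quat^'n^'n. P ** Z = 0 \<Longrightarrow> Z = 0"
  shows "P ** matrix_inv P = mat 1" "matrix_inv P ** P = mat 1"
proof -
  let ?f = "\<lambda>Z :: quat^'n^'n. P ** Z"
  have lin: "linear ?f"
    by (rule linear_matrix_mult_left)
  have "inj ?f"
    using assms lin by (simp add: linear_injective_0)
  then have "surj ?f"
    using lin linear_injective_imp_surjective by blast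
  then obtain R where R: "P ** R = mat 1"
    by (metis surjE)
  have "P ** (R ** P - mat 1) = (P ** R) ** P - P"
    by (simp add: matrix_diff_ldistrib matrix_mul_assoc)
  then have "P ** (R ** P - mat 1) = 0"
    by (simp add: R)
  then have "R ** P = mat 1"
    using assms by force
  with R have "\<exists>R. P ** R = mat 1 \<and> R ** P = mat 1"
    by blast
  then have "P ** matrix_inv P = mat 1 \<and> matrix_inv P ** P = mat 1"
    unfolding matrix_inv_def by (rule someI_ex)
  then show "P ** matrix_inv P = mat 1" "matrix_inv P ** P = mat 1"
    by auto
qed

text \<open>Since \<open>ker B\<^sup>2 = ker B\<close>, left multiplication by \<open>B\<close> maps its own range onto itself.\<close>
lemma square_divides_of_cancel:
  fixes B :: "quat^'n^'n"
  assumes "\<And>Z :: quat^'n^'n. B ** (B ** Z) = 0 \<Longrightarrow> B ** Z = 0"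
  obtains C where "B ** B ** C = B"
proof -
  let ?f = "\<lambda>Z :: quat^'n^'n. B ** Z"
  have lin: "linear ?f"
    by (rule linear_matrix_mult_left)
  have sub: "subspace (range ?f)"
    using lin linear_subspace_image subspace_UNIV by blast
  have "inj_on ?f (range ?f)"
  proof (rule inj_onI)
    fix x y assume "x \<in> range ?f" "y \<in> range ?f" and eq: "B ** x = B ** y"
    then obtain u v where uv: "x = B ** u" "y = B ** v"
      by auto
    then have "B ** (B ** (u - v)) = 0"
      using eq by (simp add: matrix_diff_ldistrib)
    then have "B ** (u - v) = 0"
      by (rule assms)
    then show "x = y"
      by (simp add: uv matrix_diff_ldistrib)
  qed
  then have "inj_on ?f (span (range ?f))"
    using sub by (simp only: span_eq_iff[THEN iffD2])
  then have "dim (?f ` range ?f) = dim (range ?f)"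
    by (rule dim_image_eq[OF lin])
  moreover have "subspace (?f ` range ?f)"
    using lin sub by (rule linear_subspace_image)
  \<comment> \<open>A subspace of the range with the same dimension is the whole range.\<close>
  ultimately have "?f ` range ?f = range ?f"
    using sub by (intro subspace_dim_equal) auto
  moreover have "B \<in> range ?f"
    by (rule range_eqI[of _ _ "mat 1"]) simp
  ultimately obtain C where "B = B ** (B ** C)"
    by blast
  then show ?thesis
    using that by (metis matrix_mul_assoc)
qed


section \<open>Positive definite quaternion matrices\<close>

lemma qposdef_hermitian: "qposdef P \<Longrightarrow> qadjoint P = P"
  by (simp add: qposdef_def qhermitian_def)

text \<open>The \<open>j\<close>-th diagonal entry of \<open>Z* P Z\<close> is the form
  \<open>x* P x\<close> at the \<open>j\<close>-th column of \<open>Z\<close>; this transfers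
  definiteness from vectors to matrices.\<close>

lemma qposdef_diagonal_pos:
  fixes P :: "quat^'n^'n" and Z :: "quat^'k^'n"
  assumes "qposdef P" and "column j Z \<noteq> 0"
  shows "0 < QRe ((qadjoint Z ** P ** Z) $ j $ j)"
proof -
  have "(qadjoint Z ** (P ** Z)) $ j $ j
      = (\<Sum>i\<in>UNIV. qcnj (column j Z $ i) * (P *v column j Z) $ i)"
    by (simp add: qadjoint_def transpose_def map_matrix_def matrix_matrix_mult_def
        matrix_vector_mult_def column_def)
  moreover obtain c where "0 < c"
      "(\<Sum>i\<in>UNIV. qcnj (column j Z $ i) * (P *v column j Z) $ i) = of_real c"
    using assms unfolding qposdef_def by blast
  ultimately show ?thesis
    by (simp add: matrix_mul_assoc)
qed

lemma qposdef_diagonal_nonneg: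
  assumes "qposdef P"
  shows "0 \<le> QRe ((qadjoint Z ** P ** Z) $ j $ j)"
proof (cases "column j Z = 0")
  case True
  then have "(qadjoint Z ** P ** Z) $ j $ j = 0"
    by (simp add: matrix_matrix_mult_def column_def vec_eq_iff)
  then show ?thesis by simp
next
  case False
  then show ?thesis using qposdef_diagonal_pos[OF assms False] by simp
qed

lemma qposdef_diagonal_cancel:
  assumes "qposdef P" and "\<And>j. QRe ((qadjoint Z ** P ** Z) $ j $ j) \<le> 0"
  shows "Z = 0"
proof -
  have "column j Z = 0" for j
    using qposdef_diagonal_pos[OF assms(1), of j Z] assms(2)[of j] by linarith
  then show ?thesis
    by (simp add: column_def vec_eq_iff)
qed

lemma qposdef_cancel:
  assumes "qposdef P" and "qadjoint Z ** P ** Z = 0"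
  shows "Z = 0"
  using assms by (intro qposdef_diagonal_cancel[of P]) simp_all

lemma qposdef_inverse:
  fixes P :: "quat^'n^'n"
  assumes "qposdef P"
  shows "P ** matrix_inv P = mat 1" "matrix_inv P ** P = mat 1"
proof -
  have "Z = 0" if "P ** Z = 0" for Z :: "quat^'n^'n"
  proof (rule qposdef_cancel[OF assms])
    show "qadjoint Z ** P ** Z = 0"
      by (simp only: that times0_right flip: matrix_mul_assoc)
  qed
  then show "P ** matrix_inv P = mat 1" "matrix_inv P ** P = mat 1"
    by (rule matrix_inverse_of_cancel; blast)+
qed


section \<open>The weighted Moore-Penrose inverse\<close>

text \<open>\<open>weighted_adjoint M N A\<close> is the adjoint of \<open>A\<close> for the inner
  products \<open>x* M y\<close> and \<open>x* N y\<close>.\<close>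

lemma weighted_adjoint_adjoint:
  assumes "qposdef M" "qposdef N"
  shows "N ** weighted_adjoint M N A = qadjoint A ** M"
    and "qadjoint (weighted_adjoint M N A) ** N = M ** A"
proof -
  show *: "N ** weighted_adjoint M N A = qadjoint A ** M"
    by (simp add: weighted_adjoint_def matrix_mul_assoc qposdef_inverse assms)
  show "qadjoint (weighted_adjoint M N A) ** N = M ** A"
    using arg_cong[OF *, of qadjoint] assms
    by (simp add: qadjoint_mult qposdef_hermitian)
qed

lemma weighted_gram:
  fixes A :: "quat^'n^'m"
  assumes "qposdef M" "qposdef N"
  defines "S \<equiv> weighted_adjoint M N A"
  shows "qadjoint S ** N ** S = M ** A ** S"
  using assms by (simp add: weighted_adjoint_adjoint)

text \<open>The Gram identity gives \<open>(S Z)* N (S Z) = Z* M (A S Z) = 0\<close>, and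
  \<open>N\<close> is definite.\<close>

lemma weighted_cancel:
  assumes "qposdef M" "qposdef N" and "A ** weighted_adjoint M N A ** Z = 0"
  shows "weighted_adjoint M N A ** Z = 0"
proof -
  let ?S = "weighted_adjoint M N A"
  have "qadjoint (?S ** Z) ** N ** (?S ** Z) = qadjoint Z ** (qadjoint ?S ** N ** ?S) ** Z"
    by (simp add: qadjoint_mult matrix_mul_assoc)
  also have "\<dots> = qadjoint Z ** M ** (A ** ?S ** Z)"
    by (simp add: weighted_gram assms(1,2) matrix_mul_assoc)
  also have "\<dots> = 0"
    by (simp only: assms(3) times0_right)
  finally show ?thesis
    by (rule qposdef_cancel[OF assms(2)])
qed

text \<open>For \<open>W = A S Z\<close> the hypothesis yields \<open>S W = 0\<close>, that is
  \<open>A* M W = 0\<close>. Then \<open>W* M W = (S Z)* (A* M W) = 0\<close>, and \<open>M\<close>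
  is definite.\<close>

lemma weighted_cancel_square:
  assumes "qposdef M" "qposdef N"
    and "A ** weighted_adjoint M N A ** (A ** weighted_adjoint M N A ** Z) = 0"
  shows "A ** weighted_adjoint M N A ** Z = 0"
proof -
  let ?S = "weighted_adjoint M N A"
  let ?W = "A ** ?S ** Z"
  have "qadjoint A ** M ** ?W = N ** (?S ** ?W)"
    by (simp add: assms weighted_adjoint_adjoint matrix_mul_assoc)
  also have "?S ** ?W = 0"
    using weighted_cancel assms by blast
  finally have 0: "qadjoint A ** M ** ?W = 0"
    by simp
  have "qadjoint ?W ** M ** ?W = qadjoint (?S ** Z) ** (qadjoint A ** M ** ?W)"
    by (simp add: qadjoint_mult matrix_mul_assoc)
  then have "qadjoint ?W ** M ** ?W = 0"
    by (simp only: 0 times0_right)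
  then show ?thesis
    by (rule qposdef_cancel[OF assms(1)])
qed

text \<open>\<open>A X\<close> and \<open>A Y\<close> are \<open>M\<close>-selfadjoint projections
  onto the range of \<open>A\<close>, hence equal; \<open>X A\<close> and \<open>Y A\<close> are
  \<open>N\<close>-selfadjoint projections with the kernel of \<open>A\<close>, hence equal. So
  \<open>X = X A X = X A Y = Y A Y = Y\<close>.\<close>

lemma weighted_mp_inverse_unique:
  assumes M: "qposdef M" and N: "qposdef N"
    and X: "is_weighted_mp_inverse M N A X" and Y: "is_weighted_mp_inverse M N A Y"
  shows "X = Y"
proof -
  have left: "A ** X = A ** Y"
    if "A ** X ** A = A" "A ** Y ** A = A" "qhermitian (M ** A ** X)" "qhermitian (M ** A ** Y)"
    for X Y
  proof -
    have hX: "qadjoint (A ** X) ** M = M ** A ** X" and hY: "qadjoint (A ** Y) ** M = M ** A ** Y"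
      using that qposdef_hermitian[OF M]
      by (metis matrix_mul_assoc qadjoint_mult qhermitian_def)+
    have "M ** (A ** X) = qadjoint (A ** X) ** M"
      by (simp add: hX matrix_mul_assoc)
    also have "\<dots> = qadjoint ((A ** Y ** A) ** X) ** M"
      using that by simp
    also have "\<dots> = qadjoint (A ** X) ** (qadjoint (A ** Y) ** M)"
      by (metis qadjoint_mult matrix_mul_assoc)
    also have "\<dots> = qadjoint (A ** X) ** M ** A ** Y"
      by (simp add: hY matrix_mul_assoc)
    also have "\<dots> = M ** (A ** X ** A) ** Y"
      by (simp add: hX matrix_mul_assoc)
    also have "\<dots> = M ** (A ** Y)"
      using that by (simp add: matrix_mul_assoc)
    finally show ?thesis
      by (metis M matrix_mul_assoc matrix_mul_lid qposdef_inverse(2))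
  qed
  have right: "X ** A = Y ** A"
    if "A ** X ** A = A" "A ** Y ** A = A" "qhermitian (N ** X ** A)" "qhermitian (N ** Y ** A)"
    for X Y
  proof -
    have hX: "qadjoint (X ** A) ** N = N ** X ** A" and hY: "qadjoint (Y ** A) ** N = N ** Y ** A"
      using that qposdef_hermitian[OF N]
      by (metis matrix_mul_assoc qadjoint_mult qhermitian_def)+
    have "N ** (X ** A) = qadjoint (X ** A) ** N"
      by (simp add: hX matrix_mul_assoc)
    also have "\<dots> = qadjoint (X ** (A ** Y ** A)) ** N"
      using that by simp
    also have "\<dots> = qadjoint (Y ** A) ** (qadjoint (X ** A) ** N)"
      by (metis qadjoint_mult matrix_mul_assoc)
    also have "\<dots> = qadjoint (Y ** A) ** N ** X ** A"
      by (simp add: hX matrix_mul_assoc)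
    also have "\<dots> = N ** Y ** (A ** X ** A)"
      by (simp add: hY matrix_mul_assoc)
    also have "\<dots> = N ** (Y ** A)"
      using that by (simp add: matrix_mul_assoc)
    finally show ?thesis
      by (metis N matrix_mul_assoc matrix_mul_lid qposdef_inverse(2))
  qed
  have "X = X ** (A ** X)"
    using X by (simp add: is_weighted_mp_inverse_def matrix_mul_assoc)
  also have "A ** X = A ** Y"
    using X Y by (intro left) (simp_all add: is_weighted_mp_inverse_def)
  also have "X ** (A ** Y) = (X ** A) ** Y"
    by (simp add: matrix_mul_assoc)
  also have "X ** A = Y ** A"
    using X Y by (intro right) (simp_all add: is_weighted_mp_inverse_def)
  also have "Y ** A ** Y = Y"
    using Y by (simp add: is_weighted_mp_inverse_def)
  finally show ?thesis .
qed

text \<open>\<open>G\<close> is the group inverse of \<open>B = A A\<^sup>\<sharp>\<close>, built from a solution \<open>C\<close> of \<open>B\<^sup>2 C = B\<close>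
  and its weighted adjoint \<open>D\<close>, which solves \<open>D B\<^sup>2 = B\<close>.\<close>
lemma weighted_mp_inverse_group_inverse:
  fixes A :: "quat^'n^'m"
  assumes M: "qposdef M" and N: "qposdef N"
  defines "S \<equiv> weighted_adjoint M N A"
  obtains G where "is_weighted_mp_inverse M N A (S ** G)"
    and "S ** G ** (A ** S) = S" and "G ** G ** (A ** S) = G"
proof -
  define B where "B = A ** S"
  have Mh: "qadjoint M = M"
    by (rule qposdef_hermitian[OF M])
  obtain C where C: "B ** B ** C = B"
    using weighted_cancel_square[OF M N, of A] unfolding B_def S_def
    by (rule square_divides_of_cancel)
  define D where "D = matrix_inv M ** qadjoint C ** M"
  have MD: "M ** D = qadjoint C ** M"
    by (simp add: D_def matrix_mul_assoc qposdef_inverse[OF M])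
  have MB: "M ** B = qadjoint B ** M"
    using weighted_adjoint_adjoint[OF M N, of A]
    unfolding B_def S_def by (metis matrix_mul_assoc qadjoint_mult)
  have M_cancel: "X = Y" if "M ** X = M ** Y" for X Y :: "quat^'k^'m"
    by (metis M that matrix_mul_assoc matrix_mul_lid qposdef_inverse(2))
  have D: "D ** B ** B = B"
  proof (rule M_cancel)
    have "M ** (D ** B ** B) = qadjoint C ** (M ** B) ** B"
      by (simp only: matrix_mul_assoc MD)
    also have "\<dots> = qadjoint C ** qadjoint B ** (M ** B)"
      by (metis MB matrix_mul_assoc)
    also have "\<dots> = qadjoint (B ** B ** C) ** M"
      by (simp only: MB) (simp only: matrix_mul_assoc qadjoint_mult)
    also have "\<dots> = M ** B"
      by (simp only: C MB)
    finally show "M ** (D ** B ** B) = M ** B" .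
  qed
  \<comment> \<open>Both sides equal \<open>D B B C\<close>.\<close>
  have BC_DB: "B ** C = D ** B"
    by (metis C D matrix_mul_assoc)
  have SC: "S ** B ** C = S"
  proof -
    \<comment> \<open>Whatever \<open>B\<close> annihilates on its right, \<open>S\<close>
      annihilates too.\<close>
    have "B ** (B ** C - mat 1) = 0"
      using C by (simp add: matrix_diff_ldistrib matrix_mul_assoc)
    then have "S ** (B ** C - mat 1) = 0"
      unfolding B_def S_def by (rule weighted_cancel[OF M N])
    then show ?thesis
      by (simp add: matrix_diff_ldistrib matrix_mul_assoc)
  qed
  \<comment> \<open>This is the weighted adjoint of \<open>S B C = S\<close>.\<close>
  have DA: "D ** B ** A = A"
  proof (rule M_cancel)
    have "M ** (D ** B ** A) = qadjoint C ** (M ** B) ** A"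
      by (simp only: matrix_mul_assoc MD)
    also have "\<dots> = qadjoint C ** qadjoint B ** (M ** A)"
      by (simp only: MB matrix_mul_assoc)
    also have "M ** A = qadjoint S ** N"
      using weighted_adjoint_adjoint[OF M N, of A] by (simp add: S_def)
    also have "qadjoint C ** qadjoint B ** (qadjoint S ** N) = qadjoint (S ** B ** C) ** N"
      by (simp only: matrix_mul_assoc qadjoint_mult)
    also have "\<dots> = M ** A"
      using weighted_adjoint_adjoint[OF M N, of A] by (simp add: SC) (simp add: S_def)
    finally show "M ** (D ** B ** A) = M ** A" .
  qed
  \<comment> \<open>With this choice \<open>B G\<close> and \<open>G B\<close> both equal the
    idempotent \<open>B C = D B\<close>.\<close>
  define G where "G = D ** B ** C"
  have BG: "B ** G = B ** C"
    unfolding G_def by (metis C BC_DB matrix_mul_assoc)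
  have GB: "G ** B = B ** C"
    unfolding G_def by (metis D BC_DB matrix_mul_assoc)
  have GGB: "G ** G ** B = G"
  proof -
    have "G ** G ** B = G ** B ** C"
      by (metis GB matrix_mul_assoc)
    also have "\<dots> = G"
      by (simp only: GB BC_DB) (simp only: G_def)
    finally show ?thesis .
  qed
  have SGB: "S ** G ** B = S"
    using GB SC by (metis matrix_mul_assoc)
  have AX: "A ** (S ** G) = D ** B"
    by (metis B_def BG BC_DB matrix_mul_assoc)
  have MG: "qadjoint (M ** G) = M ** G"
  proof -
    have MG: "M ** G = qadjoint C ** (M ** B) ** C"
      unfolding G_def by (simp only: matrix_mul_assoc MD)
    have "qadjoint (M ** B) = M ** B"
      by (metis MB Mh qadjoint_mult)
    then show ?thesis
      unfolding MG by (simp only: qadjoint_mult qadjoint_qadjoint matrix_mul_assoc)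
  qed
  have "is_weighted_mp_inverse M N A (S ** G)"
    unfolding is_weighted_mp_inverse_def
  proof (intro conjI)
    show "A ** (S ** G) ** A = A"
      by (simp only: AX DA)
    have "S ** G ** A ** (S ** G) = (S ** G ** B) ** G"
      by (simp only: B_def matrix_mul_assoc)
    then show "S ** G ** A ** (S ** G) = S ** G"
      by (simp only: SGB)
    \<comment> \<open>Moving \<open>M\<close> through \<open>D B\<close> gives
      \<open>(B C)* M\<close>, which is also the adjoint of
      \<open>M (B C) = M A S G\<close>.\<close>
    have "M ** A ** (S ** G) = M ** (D ** B)"
      by (simp only: AX flip: matrix_mul_assoc)
    also have "\<dots> = qadjoint C ** (M ** B)"
      by (simp only: matrix_mul_assoc MD)
    also have "\<dots> = qadjoint (B ** C) ** M"
      by (simp only: MB qadjoint_mult matrix_mul_assoc)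
    finally have 1: "M ** A ** (S ** G) = qadjoint (B ** C) ** M" .
    have "qadjoint (M ** A ** (S ** G)) = qadjoint (M ** (B ** C))"
      by (simp only: AX BC_DB flip: matrix_mul_assoc)
    then show "qhermitian (M ** A ** (S ** G))"
      unfolding qhermitian_def using 1 by (simp only: qadjoint_mult[of M] Mh)
    \<comment> \<open>Since \<open>N S = A* M\<close>, the matrix is a congruence transform of the
      Hermitian \<open>M G\<close>.\<close>
    have "N ** (S ** G) ** A = (N ** S) ** G ** A"
      by (simp only: matrix_mul_assoc)
    also have "\<dots> = qadjoint A ** (M ** G) ** A"
      using weighted_adjoint_adjoint[OF M N, of A] by (simp add: S_def matrix_mul_assoc)
    finally have "N ** (S ** G) ** A = qadjoint A ** (M ** G) ** A" .
    then show "qhermitian (N ** (S ** G) ** A)"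
      unfolding qhermitian_def
      by (metis MG qadjoint_mult qadjoint_qadjoint matrix_mul_assoc)
  qed
  then show ?thesis
    using that SGB GGB unfolding B_def by blast
qed


section \<open>Regularisation\<close>

text \<open>If \<open>P Z = 0\<close>, multiplying by \<open>Z* M\<close> gives
  \<open>l Z* M Z + (S Z)* N (S Z) = 0\<close>. Both terms have nonnegative diagonals and
  \<open>l > 0\<close>, so the diagonal of \<open>Z* M Z\<close> vanishes and
  \<open>Z = 0\<close>.\<close>

lemma regularised_inverse:
  fixes A :: "quat^'n^'m" and l :: real
  assumes M: "qposdef M" and N: "qposdef N" and "0 < l"
  defines "P \<equiv> l *\<^sub>R mat 1 + A ** weighted_adjoint M N A"
  shows "P ** matrix_inv P = mat 1"
proof (rule matrix_inverse_of_cancel(1))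
  fix Z :: "quat^'m^'m"
  let ?S = "weighted_adjoint M N A"
  assume "P ** Z = 0"
  then have "qadjoint Z ** M ** (P ** Z) = 0"
    by simp
  moreover have "qadjoint Z ** M ** (P ** Z)
      = l *\<^sub>R (qadjoint Z ** M ** Z) + qadjoint Z ** (M ** A ** ?S) ** Z"
    by (simp add: P_def matrix_add_ldistrib matrix_add_rdistrib matrix_mul_assoc
        matrix_scalar_ac flip: scalar_matrix_assoc)
  moreover have "qadjoint Z ** (M ** A ** ?S) ** Z = qadjoint (?S ** Z) ** N ** (?S ** Z)"
    unfolding weighted_gram[OF M N, symmetric] by (simp add: qadjoint_mult matrix_mul_assoc)
  ultimately have sum: "l *\<^sub>R (qadjoint Z ** M ** Z) + qadjoint (?S ** Z) ** N ** (?S ** Z) = 0"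
    by simp
  show "Z = 0"
  proof (rule qposdef_diagonal_cancel[OF M])
    fix j
    have "l * QRe ((qadjoint Z ** M ** Z) $ j $ j)
        + QRe ((qadjoint (?S ** Z) ** N ** (?S ** Z)) $ j $ j) = 0"
      using arg_cong[OF sum, of "\<lambda>X. QRe (X $ j $ j)"] by simp
    with qposdef_diagonal_nonneg[OF N, of "?S ** Z" j]
    have "l * QRe ((qadjoint Z ** M ** Z) $ j $ j) \<le> 0"
      by linarith
    then show "QRe ((qadjoint Z ** M ** Z) $ j $ j) \<le> 0"
      using \<open>0 < l\<close> by (simp add: mult_le_0_iff)
  qed
qed

theorem lemma3p2:
  fixes A :: "quat^'n^'m" and M :: "quat^'m^'m" and N :: "quat^'n^'n" and r :: nat
  assumes "qrank A = r"
    and "qposdef M"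
    and "qposdef N"
  shows "((\<lambda>l::real. weighted_adjoint M N A **
              matrix_inv (l *\<^sub>R mat 1 + A ** weighted_adjoint M N A))
           \<longlongrightarrow> weighted_mp_inverse M N A) (at_right 0)"
proof -
  note M = \<open>qposdef M\<close> and N = \<open>qposdef N\<close>
  define S where "S = weighted_adjoint M N A"
  define R where "R l = matrix_inv (l *\<^sub>R mat 1 + A ** S)" for l :: real
  obtain G where mp: "is_weighted_mp_inverse M N A (S ** G)"
    and SGB: "S ** G ** (A ** S) = S" and GGB: "G ** G ** (A ** S) = G"
    using weighted_mp_inverse_group_inverse[OF M N, of A] unfolding S_def by blast
  have "weighted_mp_inverse M N A = S ** G"
    unfolding weighted_mp_inverse_def
    using mp weighted_mp_inverse_unique[OF M N _ mp] by (rule the_equality)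
  have resolvent: "l *\<^sub>R (X ** R l) + X ** (A ** S) ** R l = X"
    if "0 < l" for l and X :: "quat^'m^'k"
  proof -
    have "X = X ** ((l *\<^sub>R mat 1 + A ** S) ** R l)"
      using regularised_inverse[OF M N that, of A] by (simp add: R_def S_def)
    then show ?thesis
      by (simp add: matrix_add_ldistrib matrix_add_rdistrib matrix_mul_assoc
          matrix_scalar_ac flip: scalar_matrix_assoc)
  qed
  have SR: "S ** R l = S ** G - l *\<^sub>R (S ** (G ** R l))" if "0 < l" for l
    using resolvent[OF that, of "S ** G"] SGB by (simp add: algebra_simps matrix_mul_assoc)
  have GR: "G ** R l = G ** G - l *\<^sub>R (G ** (G ** R l))" if "0 < l" for l
    using resolvent[OF that, of "G ** G"] GGB by (simp add: algebra_simps matrix_mul_assoc)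
  \<comment> \<open>\<open>a\<close> and \<open>b\<close> bound left multiplication by
    \<open>G\<close> and by \<open>S\<close>; they do not depend on \<open>l\<close>.\<close>
  obtain a where a: "a > 0" "\<And>T :: quat^'m^'m. norm (G ** T) \<le> a * norm T"
    using linear_bounded_pos[OF linear_matrix_mult_left] by blast
  obtain b where b: "b > 0" "\<And>T :: quat^'m^'m. norm (S ** T) \<le> b * norm T"
    using linear_bounded_pos[OF linear_matrix_mult_left] by blast
  \<comment> \<open>Below this threshold \<open>l * a\<close> is at most \<open>1/2\<close>, so half
    of \<open>norm (G ** R l)\<close> is absorbed on the left, whence the factor
    \<open>2\<close>.\<close>
  have GR_bound: "norm (G ** R l) \<le> 2 * norm (G ** G)" if "0 < l" "l < 1 / (2 * a)" for l
  proof -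
    have "norm (G ** R l) \<le> norm (G ** G) + norm (l *\<^sub>R (G ** (G ** R l)))"
      using GR[OF that(1)] norm_triangle_ineq4 by metis
    also have "norm (l *\<^sub>R (G ** (G ** R l))) \<le> l * (a * norm (G ** R l))"
      using a that by simp
    also have "l * (a * norm (G ** R l)) \<le> norm (G ** R l) / 2"
    proof -
      have "l * a \<le> 1 / 2"
        using that a by (simp add: field_simps)
      then show ?thesis
        using mult_right_mono[of "l * a" "1 / 2" "norm (G ** R l)"] by (simp add: mult.assoc)
    qed
    finally show ?thesis
      by simp
  qed
  have "((\<lambda>l. S ** R l) \<longlongrightarrow> S ** G) (at_right 0)"
  proof (rule LIM_zero_cancel, rule Lim_null_comparison)
    \<comment> \<open>The error is \<open>l\<close> times a quantity bounded uniformly in small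
      \<open>l\<close>, so it is squeezed to \<open>0\<close>.\<close>
    have "norm (S ** R l - S ** G) \<le> l * (b * (2 * norm (G ** G)))"
      if "0 < l" "l < 1 / (2 * a)" for l
    proof -
      have "norm (S ** R l - S ** G) = l * norm (S ** (G ** R l))"
        using SR[OF that(1)] that by simp
      also have "\<dots> \<le> l * (b * norm (G ** R l))"
        using b that by simp
      also have "\<dots> \<le> l * (b * (2 * norm (G ** G)))"
        using b GR_bound[OF that] that by simp
      finally show ?thesis .
    qed
    moreover have "1 / (2 * a) > 0"
      using a by simp
    ultimately show "\<forall>\<^sub>F l in at_right 0. norm (S ** R l - S ** G) \<le> l * (b * (2 * norm (G ** G)))"
      unfolding eventually_at_right_field by blast
    have "((\<lambda>l. l * (b * (2 * norm (G ** G)))) \<longlongrightarrow> 0 * (b * (2 * norm (G ** G)))) (at_right (0::real))"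
      by (intro tendsto_intros)
    then show "((\<lambda>l. l * (b * (2 * norm (G ** G)))) \<longlongrightarrow> 0) (at_right (0::real))"
      by simp
  qed
  then show ?thesis
    unfolding R_def S_def[symmetric] \<open>weighted_mp_inverse M N A = S ** G\<close> .
qed

end
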